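(* Let $X$ be a reflexive Banach space and let $T\in\mathcal K(X)$. Suppose that there exists $x_0^*\in E_{X^*}$ such that (i) for every $x^*\in E_{X^*}\setminus\{x_0^*\}$ and every $x\in S_X$ with $x^*(x)=1$, we have $x^*(Tx)=0$; and (ii) $T^*(x_0^* )$ is left symmetric with respect to $v_{x_0^*}(\cdot)$. Then $T$ is $nr$-left symmetric.
   Context: $X$ is over $\mathbb K$ ($\mathbb R$ or $\mathbb C$); $S_X,B_X$ denote the unit sphere and closed unit ball. $\mathcal K(X)$ is the space of compact operators on $X$; $T^*:X^*\to X^*$ is the adjoint of $T$. $E_{X^*}$ is a set of representatives of the extreme points $\operatorname{ext}(B_{X^*})$ modulo unimodular scalar multiples: $E_{X^*}\subseteq\operatorname{ext}(B_{X^*})$, no two distinct elements of $E_{X^*}$ are unimodular multiples of each other, and $\operatorname{ext}(B_{X^*})=\{\lambda x^*:x^*\in E_{X^*},\ |\lambda|=1\}$. For a Banach space $Y$ and $u\in S_Y$: $J(u)=\{\phi\in S_{Y^*}:\phi(u)=1\}$, $v_u(y)=\sup_{\phi\in J(u)}|\phi(y)|$ for $y\in Y$; $y\perp_{v_u}z$ means $v_u(y+\lambda z)\ge v_u(y)$ for all $\lambda\in\mathbb K$; $y\in Y$ is left symmetric with respect to $v_u(\cdot)$ if for every $z\in Y$, $y\perp_{v_u}z$ implies $z\perp_{v_u}y$. Here this is applied with $Y=X^*$ and $u=x_0^*\in S_{X^*}$ (so $J(x_0^* )\subset S_{X^{**}}=S_X$ by reflexivity). The numerical radius of a bounded operator $T$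 on $X$ is $w(T)=\sup\{|x^*(Tx)|:x\in S_X,\ x^*\in S_{X^*},\ x^*(x)=1\}$ (a semi-norm). Orthogonality in $\mathcal K(X)$ with respect to $w$: $T\perp_w S$ if $w(T+\lambda S)\ge w(T)$ for all $\lambda\in\mathbb K$. $T\in\mathcal K(X)$ is $nr$-left symmetric if for every $S\in\mathcal K(X)$, $T\perp_w S$ implies $S\perp_w T$. *)

theory Defs
  imports "HOL-Analysis.Analysis"
begin

text \<open>
  The scalar field is \<open>\<real>\<close> or \<open>\<complex>\<close>. The axiom of the class says that the type is isometrically
  isomorphic, as a real normed algebra, to one of the two.
\<close>

class real_or_complex = real_normed_field +
  assumes real_or_complex:
    "\<exists>h :: 'a \<Rightarrow> complex.
       (\<forall>x y. h (x + y) = h x + h y) \<and> (\<forall>x y. h (x * y) = h x * h y) \<and>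
       (\<forall>r x. h (r *\<^sub>R x) = r *\<^sub>R h x) \<and> (\<forall>x. norm (h x) = norm x) \<and>
       (range h = \<real> \<or> range h = UNIV)"

instance real :: real_or_complex
proof
  show "\<exists>h :: real \<Rightarrow> complex.
       (\<forall>x y. h (x + y) = h x + h y) \<and> (\<forall>x y. h (x * y) = h x * h y) \<and>
       (\<forall>r x. h (r *\<^sub>R x) = r *\<^sub>R h x) \<and> (\<forall>x. norm (h x) = norm x) \<and>
       (range h = \<real> \<or> range h = UNIV)"
    by (rule exI[of _ complex_of_real]) (auto simp: Reals_def scaleR_conv_of_real)
qed

instance complex :: real_or_complex
proof
  show "\<exists>h :: complex \<Rightarrow> complex.
       (\<forall>x y. h (x + y) = h x + h y) \<and> (\<forall>x y. h (x * y) = h x * h y) \<and>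
       (\<forall>r x. h (r *\<^sub>R x) = r *\<^sub>R h x) \<and> (\<forall>x. norm (h x) = norm x) \<and>
       (range h = \<real> \<or> range h = UNIV)"
    by (rule exI[of _ id]) auto
qed

text \<open>
  A normed space over the scalar field \<open>'k\<close>: the scalar multiplication \<open>smul\<close> extends the real one of
  the type \<open>'a\<close>. It is a Banach space if \<open>'a\<close> is of class \<open>banach\<close>.
\<close>

locale normed_space_over = vector_space smul
  for smul :: "'k::real_or_complex \<Rightarrow> 'a::real_normed_vector \<Rightarrow> 'a" +
  assumes scale_of_real: "smul (of_real r) x = r *\<^sub>R x"
    and norm_scale: "norm (smul c x) = norm c * norm x"

text \<open>
  The type \<open>'a \<Rightarrow>\<^sub>L 'b\<close> consists of the bounded real-linear maps. The dual space \<open>X\<^sup>*\<close> and the space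
  \<open>\<K>(X)\<close> are therefore the subspaces of \<open>'a \<Rightarrow>\<^sub>L 'k\<close> and \<open>'a \<Rightarrow>\<^sub>L 'a\<close> singled out below by linearity
  over \<open>'k\<close>. The scalar multiplication of either is the pointwise one, \<open>blinfun_scale s\<close>, where \<open>s\<close> is
  that of the codomain: \<open>(*)\<close> for functionals, \<open>smul\<close> for operators.
\<close>

definition blinfun_scale ::
    "('k::real_or_complex \<Rightarrow> 'b \<Rightarrow> 'b) \<Rightarrow> 'k \<Rightarrow> ('a::real_normed_vector \<Rightarrow>\<^sub>L 'b::real_normed_vector) \<Rightarrow> 'a \<Rightarrow>\<^sub>L 'b"
  where "blinfun_scale s c F = Blinfun (\<lambda>x. s c (blinfun_apply F x))"

lemma normed_space_over_mult: "normed_space_over ((*) :: 'k::real_or_complex \<Rightarrow> 'k \<Rightarrow> 'k)"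
  by unfold_locales (auto simp: algebra_simps norm_mult scaleR_conv_of_real)

lemma (in normed_space_over) bounded_linear_scale: "bounded_linear (smul c)"
proof (rule bounded_linear_intro)
  show "smul c (x + y) = smul c x + smul c y" for x y
    by (rule scale_right_distrib)
  show "smul c (r *\<^sub>R x) = r *\<^sub>R smul c x" for r x
    by (simp add: scale_of_real[symmetric] mult.commute)
  show "norm (smul c x) \<le> norm x * norm c" for x
    by (simp add: norm_scale mult.commute)
qed

lemma (in normed_space_over) blinfun_scale_apply:
  "blinfun_apply (blinfun_scale smul c F) x = smul c (blinfun_apply F x)"
  unfolding blinfun_scale_def
  by (subst bounded_linear_Blinfun_apply)
    (auto intro: bounded_linear_compose[OF bounded_linear_scale] blinfun.bounded_linear_right)

definition dual_space ::
    "('k::real_or_complex \<Rightarrow> 'a::real_normed_vector \<Rightarrow> 'a) \<Rightarrow> ('a \<Rightarrow>\<^sub>L 'k) set"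
  where "dual_space smul = {f. \<forall>c x. blinfun_apply f (smul c x) = c * blinfun_apply f x}"

definition compact_operators ::
    "('k::real_or_complex \<Rightarrow> 'a::real_normed_vector \<Rightarrow> 'a) \<Rightarrow> ('a \<Rightarrow>\<^sub>L 'a) set"
  where "compact_operators smul =
    {T. (\<forall>c x. blinfun_apply T (smul c x) = smul c (blinfun_apply T x)) \<and>
        compact (closure (blinfun_apply T ` cball 0 1))}"

text \<open>
  In the next definitions, \<open>Y\<close> is the carrier of a subspace of a normed space with scalar
  multiplication \<open>s\<close>. They are needed for \<open>Y = X\<^sup>*\<close>, which is not a type. A functional on \<open>Y\<close> is
  given by a function on the whole type, of which only the values on \<open>Y\<close> matter.
\<close>

definition bounded_functional_on ::
    "'b::real_normed_vector set \<Rightarrow> ('k::real_or_complex \<Rightarrow> 'b \<Rightarrow> 'b) \<Rightarrow> ('b \<Rightarrow> 'k) \<Rightarrow> bool"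
  where "bounded_functional_on Y s \<phi> \<longleftrightarrow>
    (\<forall>y\<in>Y. \<forall>z\<in>Y. \<phi> (y + z) = \<phi> y + \<phi> z) \<and>
    (\<forall>c. \<forall>y\<in>Y. \<phi> (s c y) = c * \<phi> y) \<and>
    (\<exists>B. \<forall>y\<in>Y. norm (\<phi> y) \<le> B * norm y)"

definition functional_norm_on :: "'b::real_normed_vector set \<Rightarrow> ('b \<Rightarrow> 'k::real_or_complex) \<Rightarrow> real"
  where "functional_norm_on Y \<phi> = Sup {norm (\<phi> y) | y. y \<in> Y \<and> norm y \<le> 1}"

definition support_functionals ::
    "'b::real_normed_vector set \<Rightarrow> ('k::real_or_complex \<Rightarrow> 'b \<Rightarrow> 'b) \<Rightarrow> 'b \<Rightarrow> ('b \<Rightarrow> 'k) set"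
  where "support_functionals Y s u =
    {\<phi>. bounded_functional_on Y s \<phi> \<and> functional_norm_on Y \<phi> = 1 \<and> \<phi> u = 1}"

definition support_seminorm ::
    "'b::real_normed_vector set \<Rightarrow> ('k::real_or_complex \<Rightarrow> 'b \<Rightarrow> 'b) \<Rightarrow> 'b \<Rightarrow> 'b \<Rightarrow> real"
  where "support_seminorm Y s u y = Sup {norm (\<phi> y) | \<phi>. \<phi> \<in> support_functionals Y s u}"

text \<open>Orthogonality and left symmetry with respect to a semi-norm \<open>p\<close> on the space \<open>Y\<close>.\<close>

definition orthogonal_wrt :: "('b \<Rightarrow> real) \<Rightarrow> ('k \<Rightarrow> 'b \<Rightarrow> 'b) \<Rightarrow> 'b::plus \<Rightarrow> 'b \<Rightarrow> bool"
  where "orthogonal_wrt p s y z \<longleftrightarrow> (\<forall>c. p (y + s c z) \<ge> p y)"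

definition left_symmetric_wrt ::
    "('b \<Rightarrow> real) \<Rightarrow> 'b set \<Rightarrow> ('k \<Rightarrow> 'b \<Rightarrow> 'b) \<Rightarrow> 'b::plus \<Rightarrow> bool"
  where "left_symmetric_wrt p Y s y \<longleftrightarrow>
    y \<in> Y \<and> (\<forall>z\<in>Y. orthogonal_wrt p s y z \<longrightarrow> orthogonal_wrt p s z y)"

definition reflexive_space :: "('k::real_or_complex \<Rightarrow> 'a::real_normed_vector \<Rightarrow> 'a) \<Rightarrow> bool"
  where "reflexive_space smul \<longleftrightarrow>
    (\<forall>\<phi>. bounded_functional_on (dual_space smul) (blinfun_scale (*)) \<phi> \<longrightarrow>
      (\<exists>x. \<forall>f\<in>dual_space smul. \<phi> f = blinfun_apply f x))"

definition dual_ball_extreme_points ::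
    "('k::real_or_complex \<Rightarrow> 'a::real_normed_vector \<Rightarrow> 'a) \<Rightarrow> ('a \<Rightarrow>\<^sub>L 'k) set"
  where "dual_ball_extreme_points smul =
    {f. f extreme_point_of {g \<in> dual_space smul. norm g \<le> 1}}"

definition extreme_representatives ::
    "('k::real_or_complex \<Rightarrow> 'a::real_normed_vector \<Rightarrow> 'a) \<Rightarrow> ('a \<Rightarrow>\<^sub>L 'k) set \<Rightarrow> bool"
  where "extreme_representatives smul E \<longleftrightarrow>
    E \<subseteq> dual_ball_extreme_points smul \<and>
    (\<forall>f\<in>E. \<forall>g\<in>E. f \<noteq> g \<longrightarrow> \<not> (\<exists>c. norm c = 1 \<and> g = blinfun_scale (*) c f)) \<and>
    dual_ball_extreme_points smul = {blinfun_scale (*) c f | c f. f \<in> E \<and> norm c = 1}"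

definition numerical_radius ::
    "('k::real_or_complex \<Rightarrow> 'a::real_normed_vector \<Rightarrow> 'a) \<Rightarrow> ('a \<Rightarrow>\<^sub>L 'a) \<Rightarrow> real"
  where "numerical_radius smul T =
    Sup {norm (blinfun_apply f (blinfun_apply T x)) | x f.
      norm x = 1 \<and> f \<in> dual_space smul \<and> norm f = 1 \<and> blinfun_apply f x = 1}"

definition nr_left_symmetric ::
    "('k::real_or_complex \<Rightarrow> 'a::real_normed_vector \<Rightarrow> 'a) \<Rightarrow> ('a \<Rightarrow>\<^sub>L 'a) \<Rightarrow> bool"
  where "nr_left_symmetric smul T \<longleftrightarrow>
    left_symmetric_wrt (numerical_radius smul) (compact_operators smul) (blinfun_scale smul) T"

definition adjoint_operator ::
    "('a::real_normed_vector \<Rightarrow>\<^sub>L 'a) \<Rightarrow> ('a \<Rightarrow>\<^sub>L 'k::real_normed_vector) \<Rightarrow> 'a \<Rightarrow>\<^sub>L 'k"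
  where "adjoint_operator T f = f o\<^sub>L T"

end

theory Submission
  imports Defs
begin

text \<open>
  A bounded operator on \<open>X\<close> has its numerical radius determined by the pairs \<open>(f, x)\<close> with \<open>f\<close> in \<open>E\<close>:
  for fixed \<open>x\<close>, the functionals of norm one with \<open>f x = 1\<close> form a face of the dual ball, and on
  this face \<open>\<bar>f (R x)\<bar>\<close> is dominated by its values at extreme points (\<open>numerical_radius_least\<close>). The
  pairs \<open>(x0, x)\<close> contribute \<open>v (R\<^sup>* x0)\<close>, where \<open>v\<close> is the support semi-norm at \<open>x0\<close>, because in a
  reflexive space the support functionals of \<open>x0\<close> are the evaluations at such \<open>x\<close>
  (\<open>support_seminorm_dual\<close>). By hypothesis all other pairs give the value \<open>0\<close> for \<open>T\<close>. The semi-norms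
  \<open>w\<close> and \<open>v\<close> thus carry the same information about \<open>T\<close>, and orthogonality passes from one to the other.

  If \<open>T\<close> is orthogonal to \<open>S\<close> for \<open>w\<close>, then \<open>T\<^sup>* x0\<close> is orthogonal to \<open>S\<^sup>* x0\<close> for \<open>v\<close>. Otherwise some
  \<open>T + c S\<close> is strictly smaller than \<open>T\<close> at \<open>x0\<close>; by convexity so is \<open>T + t c S\<close> for \<open>0 < t \<le> 1\<close>, and
  for small \<open>t\<close> the other pairs contribute only \<open>O(t)\<close>, so that \<open>w (T + t c S) < w T\<close>
  (\<open>nr_orthogonal_imp_adjoint_orthogonal\<close>). Left symmetry then makes \<open>S\<^sup>* x0\<close> orthogonal to \<open>T\<^sup>* x0\<close>.
  Finally, passing from \<open>S\<close> to \<open>S + c T\<close> does not lower the contribution of \<open>x0\<close> and does not change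
  that of the others, so \<open>w (S + c T) \<ge> w S\<close> (\<open>adjoint_orthogonal_imp_nr_orthogonal\<close>).

  Norming functionals and sufficiently many extreme points both come from one application of
  Zorn's lemma to sublinear functionals, without any topology on the dual space
  (\<open>extreme_linear_minorant\<close>). A sublinear functional is the support function of the set of linear
  functionals below it; the minimal ones among those whose set is a face of the set below \<open>p\<close> are the
  extreme points of the latter.
\<close>

section \<open>Sublinear functionals and their extreme linear minorants\<close>

definition sublinear :: "('a::real_vector \<Rightarrow> real) \<Rightarrow> bool"
  where "sublinear q \<longleftrightarrow>
    (\<forall>x y. q (x + y) \<le> q x + q y) \<and> (\<forall>r>0. \<forall>x. q (r *\<^sub>R x) \<le> r * q x)"

lemma sublinear_add: "sublinear q \<Longrightarrow> q (x + y) \<le> q x + q y"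
  by (simp add: sublinear_def)

lemma sublinear_zero:
  assumes "sublinear q" shows "q 0 = 0"
proof -
  have scale: "q (r *\<^sub>R x) \<le> r * q x" if "0 < r" for r x
    using assms that by (simp add: sublinear_def)
  show ?thesis using scale[of 2 0] scale[of "1/2" 0] by simp
qed

lemma sublinear_scale:
  assumes "sublinear q" "0 \<le> r" shows "q (r *\<^sub>R x) = r * q x"
proof (cases "r = 0")
  case False
  with assms have r: "0 < r" by simp
  have "q (inverse r *\<^sub>R (r *\<^sub>R x)) \<le> inverse r * q (r *\<^sub>R x)"
    using assms r unfolding sublinear_def by (meson positive_imp_inverse_positive)
  then have "r * q x \<le> q (r *\<^sub>R x)"
    using r by (simp add: field_simps)
  moreover have "q (r *\<^sub>R x) \<le> r * q x"
    using assms r unfolding sublinear_def by blast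
  ultimately show ?thesis by simp
qed (simp add: sublinear_zero assms)

lemma sublinear_neg: "sublinear q \<Longrightarrow> - q (- x) \<le> q x"
  using sublinear_add[of q x "- x"] sublinear_zero[of q] by simp

lemma sublinear_norm: "sublinear (norm :: 'a::real_normed_vector \<Rightarrow> real)"
  by (simp add: sublinear_def norm_triangle_ineq)

text \<open>
  A sublinear \<open>q\<close> is the support function of the convex set of the linear functionals below it.
  The last clause therefore says that the set below \<open>q\<close> is a face of the set below \<open>p\<close>. When \<open>q\<close> is
  linear, it is the only linear functional below itself, and the clause makes it an extreme point.
\<close>

definition face_functional :: "('a::real_vector \<Rightarrow> real) \<Rightarrow> ('a \<Rightarrow> real) \<Rightarrow> bool"
  where "face_functional p q \<longleftrightarrow> sublinear q \<and> q \<le> p \<and>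
    (\<forall>f g u. linear f \<and> linear g \<and> f \<le> p \<and> g \<le> p \<and> 0 < u \<and> u < 1 \<and>
       (\<lambda>x. (1 - u) * f x + u * g x) \<le> q \<longrightarrow> f \<le> q \<and> g \<le> q)"

lemma face_functional_sublinear: "face_functional p q \<Longrightarrow> sublinear q"
  and face_functional_le: "face_functional p q \<Longrightarrow> q \<le> p"
  by (simp_all only: face_functional_def)

lemma face_functionalD:
  assumes "face_functional p q" "linear f" "linear g" "f \<le> p" "g \<le> p" "0 < u" "u < 1"
    and "(\<lambda>x. (1 - u) * f x + u * g x) \<le> q"
  shows "f \<le> q" "g \<le> q"
  using assms unfolding face_functional_def by blast+

lemma face_functionalI:
  assumes "sublinear q" "q \<le> p"
    and "\<And>f g u. linear f \<Longrightarrow> linear g \<Longrightarrow> f \<le> p \<Longrightarrow> g \<le> p \<Longrightarrow> 0 < u \<Longrightarrow> u < 1 \<Longrightarrow>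
           (\<lambda>x. (1 - u) * f x + u * g x) \<le> q \<Longrightarrow> f \<le> q \<and> g \<le> q"
  shows "face_functional p q"
  unfolding face_functional_def using assms by blast

lemma face_functional_refl: "sublinear p \<Longrightarrow> face_functional p p"
  by (rule face_functionalI) (simp_all only: order_refl)

lemma face_functional_trans:
  assumes pq: "face_functional p q" and qr: "face_functional q r"
  shows "face_functional p r"
proof (rule face_functionalI)
  show "sublinear r" by (rule face_functional_sublinear[OF qr])
  show "r \<le> p"
    by (rule order_trans[OF face_functional_le[OF qr] face_functional_le[OF pq]])
  fix f g :: "'a \<Rightarrow> real" and u :: real
  assume fg: "linear f" "linear g" and fgp: "f \<le> p" "g \<le> p" and u: "0 < u" "u < 1"
    and le: "(\<lambda>x. (1 - u) * f x + u * g x) \<le> r"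
  note fgq = face_functionalD[OF pq fg fgp u order_trans[OF le face_functional_le[OF qr]]]
  show "f \<le> r \<and> g \<le> r"
    using face_functionalD[OF qr fg fgq u le] by (rule conjI)
qed

text \<open>
  This is the support function of the set of the linear \<open>f \<le> q\<close> with \<open>f y = q y\<close>, that is, of the
  face on which the evaluation at \<open>y\<close> is maximal.
\<close>

definition contact :: "('a::real_vector \<Rightarrow> real) \<Rightarrow> 'a \<Rightarrow> 'a \<Rightarrow> real"
  where "contact q y x = (INF t\<in>{0..}. q (x + t *\<^sub>R y) - t * q y)"

lemma contact_le:
  assumes "sublinear q" "0 \<le> t"
  shows "contact q y x \<le> q (x + t *\<^sub>R y) - t * q y"
  unfolding contact_def
proof (rule cINF_lower)
  show "bdd_below ((\<lambda>t. q (x + t *\<^sub>R y) - t * q y) ` {0..})"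
  proof (rule bdd_belowI2)
    fix t :: real assume "t \<in> {0..}"
    then have "t * q y = q ((x + t *\<^sub>R y) + - x)"
      using assms by (simp add: sublinear_scale)
    also have "\<dots> \<le> q (x + t *\<^sub>R y) + q (- x)"
      by (rule sublinear_add[OF assms(1)])
    finally show "- q (- x) \<le> q (x + t *\<^sub>R y) - t * q y" by simp
  qed
qed (use assms in simp)

lemma le_contact: "(\<And>t. 0 \<le> t \<Longrightarrow> a \<le> q (x + t *\<^sub>R y) - t * q y) \<Longrightarrow> a \<le> contact q y x"
  unfolding contact_def by (rule cINF_greatest) auto

lemma sublinear_contact:
  assumes q: "sublinear q" shows "sublinear (contact q y)"
  unfolding sublinear_def
proof (intro conjI allI impI)
  fix x z
  \<comment> \<open>Parameters \<open>s\<close> for \<open>x\<close> and \<open>t\<close> for \<open>z\<close> give the parameter \<open>s + t\<close> for \<open>x + z\<close>.\<close>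
  have "contact q y (x + z) - (q (z + t *\<^sub>R y) - t * q y) \<le> contact q y x" if t: "0 \<le> t" for t
  proof (rule le_contact)
    fix s :: real assume s: "0 \<le> s"
    have "contact q y (x + z) \<le> q ((x + z) + (s + t) *\<^sub>R y) - (s + t) * q y"
      using s t by (intro contact_le q) simp
    moreover have "q ((x + z) + (s + t) *\<^sub>R y) \<le> q (x + s *\<^sub>R y) + q (z + t *\<^sub>R y)"
      using sublinear_add[OF q, of "x + s *\<^sub>R y" "z + t *\<^sub>R y"] by (simp add: algebra_simps)
    ultimately show "contact q y (x + z) - (q (z + t *\<^sub>R y) - t * q y) \<le> q (x + s *\<^sub>R y) - s * q y"
      by (simp add: algebra_simps)
  qed
  then have "contact q y (x + z) - contact q y x \<le> contact q y z"
    by (intro le_contact) (simp add: algebra_simps)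
  then show "contact q y (x + z) \<le> contact q y x + contact q y z" by simp
next
  fix r :: real and x assume r: "0 < r"
  have "contact q y (r *\<^sub>R x) / r \<le> contact q y x"
  proof (rule le_contact)
    fix t :: real assume t: "0 \<le> t"
    have "contact q y (r *\<^sub>R x) \<le> q (r *\<^sub>R x + (r * t) *\<^sub>R y) - (r * t) * q y"
      using r t by (intro contact_le q) simp
    also have "r *\<^sub>R x + (r * t) *\<^sub>R y = r *\<^sub>R (x + t *\<^sub>R y)"
      by (simp add: algebra_simps)
    also have "q \<dots> = r * q (x + t *\<^sub>R y)"
      using r by (simp add: sublinear_scale[OF q])
    finally show "contact q y (r *\<^sub>R x) / r \<le> q (x + t *\<^sub>R y) - t * q y"
      using r by (simp add: field_simps)
  qed
  then show "contact q y (r *\<^sub>R x) \<le> r * contact q y x"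
    using r by (simp add: field_simps)
qed

lemma contact_le_self: "sublinear q \<Longrightarrow> contact q y \<le> q"
  using contact_le[of q 0] by (simp add: le_fun_def)

lemma linear_le_contact_iff:
  assumes q: "sublinear q" and f: "linear f" "f \<le> q"
  shows "f \<le> contact q y \<longleftrightarrow> f y = q y"
proof
  assume "f \<le> contact q y"
  then have "f (- y) \<le> contact q y (- y)" by (simp add: le_fun_def)
  also have "\<dots> \<le> - q y"
    using contact_le[OF q, of 1 y "- y"] sublinear_zero[OF q] by simp
  finally have "q y \<le> f y" using f(1) by (simp add: linear_neg)
  with f(2) show "f y = q y" by (simp add: le_fun_def order_antisym)
next
  assume eq: "f y = q y"
  show "f \<le> contact q y"
  proof (rule le_funI, rule le_contact)
    fix x t
    have "f x + t * f y = f (x + t *\<^sub>R y)"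
      using f(1) by (simp add: linear_add linear_scale)
    also have "\<dots> \<le> q (x + t *\<^sub>R y)"
      using f(2) by (simp add: le_fun_def)
    finally show "f x \<le> q (x + t *\<^sub>R y) - t * q y" by (simp add: eq)
  qed
qed

text \<open>Where a proper convex combination attains a common upper bound, both its members do.\<close>

lemma face_functional_contact:
  assumes q: "sublinear q" shows "face_functional q (contact q y)"
proof (rule face_functionalI)
  fix f g :: "'a \<Rightarrow> real" and u :: real
  assume lin: "linear f" "linear g" and le: "f \<le> q" "g \<le> q" and u: "0 < u" "u < 1"
    and comb: "(\<lambda>x. (1 - u) * f x + u * g x) \<le> contact q y"
  have "(1 - u) * f (- y) + u * g (- y) \<le> contact q y (- y)"
    using comb by (simp add: le_fun_def)
  also have "\<dots> \<le> - q y"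
    using contact_le[OF q, of 1 y "- y"] sublinear_zero[OF q] by simp
  finally have "(1 - u) * (q y - f y) + u * (q y - g y) \<le> 0"
    using lin by (simp add: linear_neg algebra_simps)
  moreover have "0 \<le> q y - f y" "0 \<le> q y - g y"
    using le by (simp_all add: le_fun_def)
  ultimately have "(1 - u) * (q y - f y) = 0" "u * (q y - g y) = 0"
    using u by (smt (verit) mult_nonneg_nonneg)+
  then have "f y = q y" "g y = q y" using u by auto
  then show "f \<le> contact q y \<and> g \<le> contact q y"
    by (simp only: linear_le_contact_iff[OF q] lin le simp_thms)
next
  show "sublinear (contact q y)" by (rule sublinear_contact[OF q])
  show "contact q y \<le> q" by (rule contact_le_self[OF q])
qed

lemma face_functional_chain_Inf:
  assumes C: "C \<noteq> {}" "\<And>q. q \<in> C \<Longrightarrow> face_functional p q"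
    and chain: "\<And>q r. q \<in> C \<Longrightarrow> r \<in> C \<Longrightarrow> q \<le> r \<or> r \<le> q"
  shows "face_functional p (\<lambda>x. INF q\<in>C. q x)"
    and "q \<in> C \<Longrightarrow> (\<lambda>x. INF q\<in>C. q x) \<le> q"
proof -
  define m where "m = (\<lambda>x. INF q\<in>C. q x)"
  have sub: "sublinear q" and le: "q \<le> p" if "q \<in> C" for q
    using C(2)[OF that] by (rule face_functional_sublinear, intro face_functional_le C(2) that)
  have bdd: "bdd_below ((\<lambda>q. q x) ` C)" for x
  proof (rule bdd_belowI2)
    fix q assume "q \<in> C"
    then show "- p (- x) \<le> q x"
      using sublinear_neg[OF sub, of q x] le[of q] by (smt (verit) le_funD)
  qed
  have lower: "m x \<le> q x" if "q \<in> C" for q x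
    unfolding m_def by (rule cINF_lower[OF bdd that])
  have greatest: "a \<le> m x" if "\<And>q. q \<in> C \<Longrightarrow> a \<le> q x" for a x
    unfolding m_def using C(1) that by (intro cINF_greatest)
  have "sublinear m"
    unfolding sublinear_def
  proof (intro conjI allI impI)
    fix x y
    have le2: "m (x + y) \<le> q x + r y" if qr: "q \<in> C" "r \<in> C" for q r
    proof -
      \<comment> \<open>Both values are at least those of the smaller of the two functionals.\<close>
      obtain s where s: "s \<in> C" "s \<le> q" "s \<le> r"
        using chain qr by blast
      have "m (x + y) \<le> s (x + y)" by (rule lower[OF s(1)])
      also have "\<dots> \<le> s x + s y" by (rule sublinear_add[OF sub[OF s(1)]])
      also have "\<dots> \<le> q x + r y" using s by (intro add_mono) (auto simp: le_fun_def)
      finally show ?thesis .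
    qed
    have "m (x + y) - q x \<le> m y" if "q \<in> C" for q
    proof (rule greatest)
      show "m (x + y) - q x \<le> r y" if "r \<in> C" for r
        using le2[OF \<open>q \<in> C\<close> that] by linarith
    qed
    then have "m (x + y) - m y \<le> m x"
      by (intro greatest) (simp add: diff_le_eq add.commute)
    then show "m (x + y) \<le> m x + m y" by simp
  next
    fix r :: real and x assume r: "0 < r"
    have "m (r *\<^sub>R x) / r \<le> m x"
    proof (rule greatest)
      fix q assume "q \<in> C"
      then show "m (r *\<^sub>R x) / r \<le> q x"
        using lower[of q "r *\<^sub>R x"] sublinear_scale[OF sub, of q r x] r by (simp add: field_simps)
    qed
    then show "m (r *\<^sub>R x) \<le> r * m x"
      using r by (simp add: field_simps)
  qed
  moreover have "m \<le> p"
  proof -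
    obtain q where "q \<in> C" using C(1) by blast
    with lower le show ?thesis by (meson le_funD le_funI order_trans)
  qed
  moreover have "f \<le> m \<and> g \<le> m"
    if fg: "linear f" "linear g" "f \<le> p" "g \<le> p" "0 < u" "u < 1"
      and comb: "(\<lambda>x. (1 - u) * f x + u * g x) \<le> m" for f g u
  proof -
    have "f \<le> q \<and> g \<le> q" if "q \<in> C" for q
    proof -
      have "m \<le> q" using lower[OF that] by (simp add: le_fun_def)
      with comb have "(\<lambda>x. (1 - u) * f x + u * g x) \<le> q" by (rule order_trans)
      with face_functionalD[OF C(2)[OF that] fg] show ?thesis by (simp only: simp_thms)
    qed
    then show ?thesis by (auto simp: le_fun_def intro!: greatest)
  qed
  ultimately show "face_functional p (\<lambda>x. INF q\<in>C. q x)"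
    unfolding m_def[symmetric] by (rule face_functionalI)
  show "(\<lambda>x. INF q\<in>C. q x) \<le> q" if "q \<in> C"
    using lower[OF that] by (simp add: le_fun_def m_def)
qed

text \<open>
  A minimal face functional \<open>q\<close> satisfies \<open>contact q y = q\<close> for all \<open>y\<close>. At \<open>- y\<close> this
  gives \<open>q (- y) = - q y\<close>, and a sublinear functional that is odd is linear.
\<close>

lemma extreme_linear_minorant:
  fixes p :: "'a::real_vector \<Rightarrow> real"
  assumes p: "sublinear p"
  shows "\<exists>f. linear f \<and> face_functional p f"
proof -
  define A where "A = Collect (face_functional p)"
  have "\<exists>m\<in>A. \<forall>a\<in>A. m \<ge> a \<longrightarrow> a = m"
  proof (rule predicate_Zorn)
    show "partial_order_on A (relation_of (\<ge>) A)"
      by (rule partial_order_on_relation_ofI) auto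
    fix C assume "C \<in> Chains (relation_of (\<ge>) A)"
    then have C: "C \<subseteq> A" "\<And>q r. q \<in> C \<Longrightarrow> r \<in> C \<Longrightarrow> q \<le> r \<or> r \<le> q"
      by (auto simp: Chains_def relation_of_def)
    show "\<exists>u\<in>A. \<forall>a\<in>C. a \<ge> u"
    proof (cases "C = {}")
      case True
      then show ?thesis using p face_functional_refl by (auto simp: A_def)
    next
      case False
      have "face_functional p (\<lambda>x. INF q\<in>C. q x)" "\<And>q. q \<in> C \<Longrightarrow> (\<lambda>x. INF q\<in>C. q x) \<le> q"
        using C by (intro face_functional_chain_Inf False; auto simp: A_def)+
      then show ?thesis unfolding A_def by blast
    qed
  qed
  then obtain q where q: "face_functional p q"
    and min: "\<And>r. face_functional p r \<Longrightarrow> r \<le> q \<Longrightarrow> r = q"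
    unfolding A_def by blast
  note sub = face_functional_sublinear[OF q]
  have odd: "q (- y) = - q y" for y
  proof -
    have "contact q y = q"
      by (rule min[OF face_functional_trans[OF q face_functional_contact[OF sub]] contact_le_self[OF sub]])
    then have "q (- y) \<le> - q y"
      using contact_le[OF sub, of 1 y "- y"] sublinear_zero[OF sub] by simp
    with sublinear_neg[OF sub, of y] show ?thesis by simp
  qed
  have "linear q"
  proof (rule linearI)
    fix x y
    have "- q (x + y) = q (- x + - y)"
      using odd[of "x + y"] by (simp add: algebra_simps)
    also have "\<dots> \<le> - q x - q y"
      using sublinear_add[OF sub, of "- x" "- y"] by (simp add: odd)
    finally show "q (x + y) = q x + q y"
      using sublinear_add[OF sub, of x y] by simp
  next
    fix r :: real and x
    show "q (r *\<^sub>R x) = r *\<^sub>R q x"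
    proof (cases "0 \<le> r")
      case False
      then have "q ((- r) *\<^sub>R x) = - r * q x" by (intro sublinear_scale sub) simp
      then show ?thesis using odd[of "r *\<^sub>R x"] by simp
    qed (simp add: sublinear_scale[OF sub])
  qed
  with q show ?thesis by blast
qed

lemma extreme_linear_minorant_at:
  assumes p: "sublinear p"
  shows "\<exists>f. linear f \<and> face_functional p f \<and> f x = p x"
proof -
  obtain f where f: "linear f" "face_functional (contact p x) f"
    using extreme_linear_minorant[OF sublinear_contact[OF p]] by blast
  have pf: "face_functional p f"
    by (rule face_functional_trans[OF face_functional_contact[OF p] f(2)])
  have "f x = p x"
    using linear_le_contact_iff[OF p f(1) face_functional_le[OF pf]] face_functional_le[OF f(2)]
    by blast
  with f pf show ?thesis by blast
qed

text \<open>
  Lexicographic maximisation: an extreme point of the face that is maximal at \<open>x\<close>, chosen to be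
  maximal at \<open>z\<close> within that face.
\<close>

lemma extreme_linear_minorant_dominating:
  assumes p: "sublinear p" and g: "linear g" "g \<le> p" "g x = p x"
  shows "\<exists>f. linear f \<and> face_functional p f \<and> f x = p x \<and> g z \<le> f z"
proof -
  have c: "sublinear (contact p x)" by (rule sublinear_contact[OF p])
  obtain f where f: "linear f" "face_functional (contact p x) f" "f z = contact p x z"
    using extreme_linear_minorant_at[OF c] by blast
  have pf: "face_functional p f"
    by (rule face_functional_trans[OF face_functional_contact[OF p] f(2)])
  have "f x = p x"
    using linear_le_contact_iff[OF p f(1) face_functional_le[OF pf]] face_functional_le[OF f(2)]
    by blast
  moreover have "g \<le> contact p x"
    using linear_le_contact_iff[OF p g(1,2)] g(3) by blast
  then have "g z \<le> f z" by (simp add: f(3) le_fun_def)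
  ultimately show ?thesis using f(1) pf by blast
qed

section \<open>Real parts of functionals\<close>

text \<open>
  The element \<open>j\<close> is an imaginary unit when the scalar field is complex and \<open>0\<close> when it is real; the
  last clause recovers a scalar from the real parts of \<open>c\<close> and \<open>j * c\<close> in both cases.
\<close>

definition real_part :: "('k::real_or_complex \<Rightarrow> real) \<Rightarrow> 'k \<Rightarrow> bool"
  where "real_part \<rho> j \<longleftrightarrow> linear \<rho> \<and> (\<forall>r. \<rho> (of_real r) = r) \<and> (\<forall>c. (norm c)\<^sup>2 = (\<rho> c)\<^sup>2 + (\<rho> (j * c))\<^sup>2) \<and>
    (j = 0 \<or> j * j = -1) \<and> (\<forall>c. c = of_real (\<rho> c) - j * of_real (\<rho> (j * c)))"

lemma real_partD:
  assumes "real_part \<rho> j"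
  shows "linear \<rho>" "\<rho> (of_real r) = r" "(norm c)\<^sup>2 = (\<rho> c)\<^sup>2 + (\<rho> (j * c))\<^sup>2"
    "j = 0 \<or> j * j = -1" "c = of_real (\<rho> c) - j * of_real (\<rho> (j * c))"
  using assms unfolding real_part_def by blast+

lemma real_part_le_norm:
  assumes "real_part \<rho> j" shows "\<rho> c \<le> norm c"
proof (rule power2_le_imp_le)
  show "(\<rho> c)\<^sup>2 \<le> (norm c)\<^sup>2" by (simp add: real_partD(3)[OF assms])
qed simp

lemma real_part_eq_oneD:
  assumes \<rho>: "real_part \<rho> j" and c: "\<rho> c = 1" "norm c \<le> 1"
  shows "c = 1"
proof -
  have "(norm c)\<^sup>2 \<le> 1" using c(2) by (simp add: power_le_one)
  then have "(\<rho> (j * c))\<^sup>2 \<le> 0"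
    using real_partD(3)[OF \<rho>, of c] c(1) by simp
  then have "\<rho> (j * c) = 0" by simp
  then show ?thesis
    using real_partD(5)[OF \<rho>, of c] c(1) by simp
qed

lemma real_part_exists: "\<exists>\<rho> (j::'k::real_or_complex). real_part \<rho> j"
proof -
  obtain h :: "'k \<Rightarrow> complex" where add: "\<And>x y. h (x + y) = h x + h y"
    and mult: "\<And>x y. h (x * y) = h x * h y"
    and scale: "\<And>r x. h (r *\<^sub>R x) = r *\<^sub>R h x" and nrm: "\<And>x. norm (h x) = norm x"
    and range: "range h = \<real> \<or> range h = UNIV"
    using real_or_complex[where 'a='k] by blast
  have diff: "h (x - y) = h x - h y" for x y
    using add[of "x - y" y] by simp
  have inj: "x = y" if "h x = h y" for x y
    using that diff[of x y] nrm[of "x - y"] by simp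
  have one: "h 1 = 1"
    using mult[of 1 1] nrm[of 1] by (metis mult.left_neutral mult_cancel_right norm_zero zero_neq_one norm_one)
  have real: "h (of_real r) = of_real r" for r
    using scale[of r 1] one by (simp add: of_real_def)
  define \<rho> where "\<rho> = (\<lambda>c. Re (h c))"
  have lin: "linear \<rho>"
    by (rule linearI) (simp_all add: \<rho>_def add scale)
  have real': "\<rho> (of_real r) = r" for r
    by (simp add: \<rho>_def real)
  have sq: "(norm c)\<^sup>2 = (Re (h c))\<^sup>2 + (Im (h c))\<^sup>2" for c
    by (metis nrm cmod_power2)
  from range show ?thesis
  proof
    assume R: "range h = \<real>"
    have "h c \<in> \<real>" for c using R by blast
    then have "Im (h c) = 0" for c by (simp add: complex_is_Real_iff)
    then have "(norm c)\<^sup>2 = (\<rho> c)\<^sup>2" "c = of_real (\<rho> c)" for c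
      by (simp_all add: sq \<rho>_def inj real complex_eq_iff)
    then have "real_part \<rho> 0"
      unfolding real_part_def mult_zero_left linear_0[OF lin] using lin real' by auto
    then show ?thesis by blast
  next
    assume "range h = UNIV"
    then obtain j where j: "h j = \<i>" by (metis UNIV_I image_iff)
    have neg: "h (- 1) = - 1"
      using diff[of 0 1] diff[of 0 0] one by simp
    have "j * j = -1"
      by (rule inj) (simp add: mult j neg)
    moreover have "c = of_real (\<rho> c) - j * of_real (\<rho> (j * c))" for c
      by (rule inj) (simp add: diff add mult real j \<rho>_def complex_eq_iff)
    moreover have "(norm c)\<^sup>2 = (\<rho> c)\<^sup>2 + (\<rho> (j * c))\<^sup>2" for c
      by (simp add: sq \<rho>_def mult j)
    ultimately have "real_part \<rho> j"
      unfolding real_part_def using lin real' by blast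
    then show ?thesis by blast
  qed
qed

lemma rotate_to_norm:
  fixes a :: "'k::real_or_complex"
  shows "\<exists>c. norm c = 1 \<and> c * a = of_real (norm a)"
proof (cases "a = 0")
  case False
  then show ?thesis
    by (intro exI[of _ "of_real (norm a) / a"]) (simp add: norm_divide)
qed (auto intro: exI[of _ 1])

context normed_space_over
begin

lemma dual_scale: "f \<in> dual_space smul \<Longrightarrow> f (smul c x) = c * f x"
  by (simp add: dual_space_def)

lemma dual_eqI:
  assumes "real_part \<rho> j" "f \<in> dual_space smul" "g \<in> dual_space smul"
    and eq: "\<And>x. \<rho> (f x) = \<rho> (g x)"
  shows "f = g"
proof (rule blinfun_eqI)
  fix x
  obtain c where c: "c * (f x - g x) = of_real (norm (f x - g x))"
    using rotate_to_norm by blast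
  have "f (smul c x) - g (smul c x) = of_real (norm (f x - g x))"
    using assms(2,3) c by (simp add: dual_scale right_diff_distrib)
  then have "norm (f x - g x) = \<rho> (f (smul c x) - g (smul c x))"
    by (simp only: real_partD(2)[OF assms(1)])
  also have "\<dots> = 0"
    by (simp add: linear_diff[OF real_partD(1)[OF assms(1)]] eq)
  finally show "f x = g x" by simp
qed

text \<open>The complexification of Bohnenblust and Sobczyk; it keeps the norm because scalars rotate.\<close>

lemma functional_with_real_part:
  assumes \<rho>: "real_part \<rho> j" and g: "linear g" "g \<le> norm"
  shows "\<exists>G\<in>dual_space smul. norm G \<le> 1 \<and> (\<forall>x. \<rho> (blinfun_apply G x) = g x)"
proof -
  define G where "G = (\<lambda>x. of_real (g x) - j * of_real (g (smul j x)) :: 'k)"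
  have lin: "linear \<rho>" and real: "\<rho> (of_real r) = r" and j: "j = 0 \<or> j * j = -1"
    and split: "c = of_real (\<rho> c) - j * of_real (\<rho> (j * c))" for r c
    by (fact real_partD[OF \<rho>])+
  have \<rho>j: "\<rho> j = 0"
    using split[of 1] real[of 1] j linear_0[OF lin] by (cases "j = 0") auto
  have add: "G (x + y) = G x + G y" for x y
    using g(1) by (simp add: G_def linear_add scale_right_distrib algebra_simps)
  have scR: "G (r *\<^sub>R x) = of_real r * G x" for r x
  proof -
    have "smul j (r *\<^sub>R x) = r *\<^sub>R smul j x"
      by (rule linear_scale[OF bounded_linear.linear[OF bounded_linear_scale]])
    then show ?thesis
      using g(1) by (simp add: G_def linear_scale algebra_simps)
  qed
  have Gj: "G (smul j x) = j * G x" for x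
    using j
  proof
    assume "j * j = -1"
    moreover from this have "smul j (smul j x) = - x" by simp
    ultimately show ?thesis
      using g(1) by (simp add: G_def linear_neg algebra_simps flip: mult.assoc)
  qed (use g(1) in \<open>simp add: G_def linear_0\<close>)
  have Gc: "G (smul c x) = c * G x" for c x
  proof -
    define a b where "a = \<rho> c" and "b = - \<rho> (j * c)"
    have c: "c = of_real a + of_real b * j"
      using split[of c] by (simp add: a_def b_def mult.commute)
    have "smul c x = a *\<^sub>R x + b *\<^sub>R smul j x"
      unfolding c scale_of_real[symmetric] by (simp add: scale_left_distrib)
    then show ?thesis
      by (simp only: add scR Gj) (simp add: c algebra_simps)
  qed
  have \<rho>G: "\<rho> (G x) = g x" for x
  proof -
    have "\<rho> (j * of_real r) = r * \<rho> j" for r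
      using linear_scale[OF lin, of r j] by (simp add: scaleR_conv_of_real mult.commute)
    then show ?thesis
      by (simp add: G_def linear_diff[OF lin] real \<rho>j)
  qed
  have bound: "norm (G x) \<le> norm x" for x
  proof -
    obtain c where c: "norm c = 1" "c * G x = of_real (norm (G x))"
      using rotate_to_norm by blast
    have "norm (G x) = g (smul c x)"
      using \<rho>G[of "smul c x"] by (simp add: Gc c real)
    also have "\<dots> \<le> norm (smul c x)"
      using g(2) by (simp add: le_fun_def)
    finally show ?thesis by (simp add: norm_scale c)
  qed
  have bl: "bounded_linear G"
    by (rule bounded_linear_intro[where K = 1])
      (simp_all add: add scR bound scaleR_conv_of_real)
  show ?thesis
  proof (intro bexI[of _ "Blinfun G"] conjI allI)
    show "norm (Blinfun G) \<le> 1"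
      by (rule norm_blinfun_bound) (simp_all add: bounded_linear_Blinfun_apply[OF bl] bound)
  qed (simp_all add: dual_space_def bounded_linear_Blinfun_apply[OF bl] Gc \<rho>G)
qed

section \<open>Norming functionals and extreme points of the dual ball\<close>

lemma norming_functional:
  "\<exists>f\<in>dual_space smul. norm f \<le> 1 \<and> norm x \<le> norm (blinfun_apply f x)"
proof -
  obtain \<rho> and j :: 'k where \<rho>: "real_part \<rho> j" using real_part_exists by blast
  obtain g where g: "linear g" "face_functional norm g" "g x = norm x"
    using extreme_linear_minorant_at[OF sublinear_norm] by blast
  then have "g \<le> norm" by (intro face_functional_le)
  with g \<rho> obtain f where f: "f \<in> dual_space smul" "norm f \<le> 1" "\<rho> (f x) = norm x"
    by (metis functional_with_real_part)
  moreover have "\<rho> (f x) \<le> norm (f x)"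
    by (rule real_part_le_norm[OF \<rho>])
  ultimately show ?thesis by auto
qed

text \<open>
  Taking real parts is an affine bijection from the dual ball onto the set of the linear functionals
  below the norm, so it preserves and reflects extreme points.
\<close>

lemma extreme_point_of_real_part:
  assumes \<rho>: "real_part \<rho> j" and G: "G \<in> dual_space smul" "norm G \<le> 1"
    and ext: "face_functional norm (\<lambda>x. \<rho> (G x))"
  shows "G \<in> dual_ball_extreme_points smul"
proof -
  note lin\<rho> = real_partD(1)[OF \<rho>]
  have lin: "linear (\<lambda>x. \<rho> (blinfun_apply F x))" for F :: "'a \<Rightarrow>\<^sub>L 'k"
    by (rule linear_compose[unfolded o_def, OF _ lin\<rho>])
      (rule bounded_linear.linear, rule blinfun.bounded_linear_right)
  have below: "(\<lambda>x. \<rho> (F x)) \<le> norm" if "norm F \<le> 1" for F :: "'a \<Rightarrow>\<^sub>L 'k"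
  proof (rule le_funI)
    fix x
    have "\<rho> (F x) \<le> norm (F x)" by (rule real_part_le_norm[OF \<rho>])
    also have "\<dots> \<le> norm F * norm x" by (rule norm_blinfun)
    also have "\<dots> \<le> norm x" using that by (simp add: mult_left_le_one_le)
    finally show "\<rho> (F x) \<le> norm x" .
  qed
  have eqG: "F = G" if F: "F \<in> dual_space smul" and le: "(\<lambda>x. \<rho> (F x)) \<le> (\<lambda>x. \<rho> (G x))" for F
  proof (rule dual_eqI[OF \<rho> F G(1)])
    fix x
    have "\<rho> (F x) \<le> \<rho> (G x)" "\<rho> (F (- x)) \<le> \<rho> (G (- x))"
      using le by (simp_all add: le_fun_def)
    then show "\<rho> (F x) = \<rho> (G x)"
      using linear_neg[OF lin, of F x] linear_neg[OF lin, of G x] by simp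
  qed
  have "\<not> G \<in> open_segment a b"
    if a: "a \<in> dual_space smul" "norm a \<le> 1" and b: "b \<in> dual_space smul" "norm b \<le> 1" for a b
  proof
    assume "G \<in> open_segment a b"
    then obtain u where ab: "a \<noteq> b" and u: "0 < u" "u < 1" and Gu: "G = (1 - u) *\<^sub>R a + u *\<^sub>R b"
      by (auto simp: in_segment)
    have "(\<lambda>x. (1 - u) * \<rho> (a x) + u * \<rho> (b x)) \<le> (\<lambda>x. \<rho> (G x))"
      by (simp add: Gu blinfun.bilinear_simps linear_add[OF lin\<rho>] linear_scale[OF lin\<rho>])
    then have "(\<lambda>x. \<rho> (a x)) \<le> (\<lambda>x. \<rho> (G x)) \<and> (\<lambda>x. \<rho> (b x)) \<le> (\<lambda>x. \<rho> (G x))"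
      using face_functionalD[OF ext lin lin below[OF a(2)] below[OF b(2)] u] by blast
    then have "a = G" "b = G" using eqG a b by blast+
    with ab show False by simp
  qed
  then show ?thesis
    using G unfolding dual_ball_extreme_points_def extreme_point_of_def by blast
qed

lemma extreme_point_dominating:
  assumes f: "f \<in> dual_space smul" "norm f \<le> 1" and x: "norm x = 1" "f x = 1"
  shows "\<exists>g\<in>dual_ball_extreme_points smul. g \<in> dual_space smul \<and> norm g \<le> 1 \<and>
           blinfun_apply g x = 1 \<and> norm (blinfun_apply f z) \<le> norm (blinfun_apply g z)"
proof -
  obtain \<rho> and j :: 'k where \<rho>: "real_part \<rho> j" using real_part_exists by blast
  note lin\<rho> = real_partD(1)[OF \<rho>] and real = real_partD(2)[OF \<rho>] and le = real_part_le_norm[OF \<rho>]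
  \<comment> \<open>Real parts only control \<open>f z\<close> after it has been rotated to the positive half-line.\<close>
  obtain c where c: "norm c = 1" "c * f z = of_real (norm (f z))"
    using rotate_to_norm by blast
  have lin: "linear (\<lambda>x. \<rho> (f x))"
    by (rule linear_compose[unfolded o_def, OF _ lin\<rho>])
      (rule bounded_linear.linear, rule blinfun.bounded_linear_right)
  have nb: "norm (F y) \<le> norm y" if "norm F \<le> 1" for F :: "'a \<Rightarrow>\<^sub>L 'k" and y
    using norm_blinfun[of F y] that mult_right_mono[of "norm F" 1 "norm y"] by simp
  have below: "(\<lambda>x. \<rho> (f x)) \<le> norm"
    by (rule le_funI, rule order_trans[OF le nb[OF f(2)]])
  have "\<rho> (f x) = norm x" using real[of 1] x by simp
  then obtain g where g: "linear g" "face_functional norm g" "g x = norm x"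
      "\<rho> (f (smul c z)) \<le> g (smul c z)"
    using extreme_linear_minorant_dominating[OF sublinear_norm lin below, of x "smul c z"] by blast
  then have "g \<le> norm" by (intro face_functional_le)
  with g(1) \<rho> obtain G where G: "G \<in> dual_space smul" "norm G \<le> 1" and \<rho>G: "\<And>x. \<rho> (G x) = g x"
    by (metis functional_with_real_part)
  have "G \<in> dual_ball_extreme_points smul"
    using extreme_point_of_real_part[OF \<rho> G] g(2) by (simp add: \<rho>G)
  moreover have "G x = 1"
    using real_part_eq_oneD[OF \<rho>, of "G x"] nb[OF G(2), of x] g(3) x(1) by (simp add: \<rho>G)
  moreover have "norm (f z) \<le> norm (G z)"
  proof -
    have "norm (f z) = \<rho> (f (smul c z))" using f c real by (simp add: dual_scale)
    also have "\<dots> \<le> \<rho> (G (smul c z))" using g(4) by (simp add: \<rho>G)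
    also have "\<dots> \<le> norm (G z)" using le[of "G (smul c z)"] G c by (simp add: dual_scale norm_mult)
    finally show ?thesis .
  qed
  ultimately show ?thesis using G by blast
qed


section \<open>The numerical radius and the support semi-norm\<close>

lemma numerical_radius_upper:
  assumes "norm x = 1" "f \<in> dual_space smul" "norm f = 1" "f x = 1"
  shows "norm (f (blinfun_apply R x)) \<le> numerical_radius smul R"
  unfolding numerical_radius_def
proof (rule cSup_upper)
  show "bdd_above {norm (blinfun_apply f (blinfun_apply R x)) | x f.
      norm x = 1 \<and> f \<in> dual_space smul \<and> norm f = 1 \<and> blinfun_apply f x = 1}"
  proof (rule bdd_aboveI, clarify)
    fix x :: 'a and f :: "'a \<Rightarrow>\<^sub>L 'k"
    assume "norm x = 1" "norm f = 1"
    then show "norm (f (R x)) \<le> norm R"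
      using norm_blinfun[of f "R x"] norm_blinfun[of R x] by simp
  qed
qed (use assms in blast)

text \<open>
  Reflexivity turns a support functional into an evaluation at some \<open>x\<close>. That \<open>norm x \<le> 1\<close> follows
  because \<open>x\<close> has a norming functional.
\<close>

lemma support_functional_eval:
  assumes refl: "reflexive_space smul" and u: "u \<in> dual_space smul" "norm u \<le> 1"
    and \<phi>: "\<phi> \<in> support_functionals (dual_space smul) (blinfun_scale (*)) u"
  shows "\<exists>x. norm x = 1 \<and> u x = 1 \<and> (\<forall>f\<in>dual_space smul. \<phi> f = f x)"
proof -
  have bf: "bounded_functional_on (dual_space smul) (blinfun_scale (*)) \<phi>"
    and nrm: "functional_norm_on (dual_space smul) \<phi> = 1" and \<phi>u: "\<phi> u = 1"
    using \<phi> by (auto simp: support_functionals_def)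
  obtain x where x: "\<And>f. f \<in> dual_space smul \<Longrightarrow> \<phi> f = f x"
    using refl bf unfolding reflexive_space_def by blast
  obtain f where f: "f \<in> dual_space smul" "norm f \<le> 1" "norm x \<le> norm (f x)"
    using norming_functional by blast
  obtain B where B: "\<And>g. g \<in> dual_space smul \<Longrightarrow> norm (\<phi> g) \<le> B * norm g"
    using bf unfolding bounded_functional_on_def by blast
  have "bdd_above {norm (\<phi> g) | g. g \<in> dual_space smul \<and> norm g \<le> 1}"
  proof (rule bdd_aboveI, clarify)
    fix g :: "'a \<Rightarrow>\<^sub>L 'k" assume g: "g \<in> dual_space smul" "norm g \<le> 1"
    have "norm (\<phi> g) \<le> \<bar>B\<bar> * norm g"
      using B[OF g(1)] by (rule order_trans) (simp add: mult_right_mono)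
    also have "\<dots> \<le> \<bar>B\<bar>" using g(2) by (simp add: mult_left_le)
    finally show "norm (\<phi> g) \<le> \<bar>B\<bar>" .
  qed
  then have "norm (\<phi> f) \<le> functional_norm_on (dual_space smul) \<phi>"
    unfolding functional_norm_on_def by (rule cSup_upper[rotated]) (use f in blast)
  then have "norm x \<le> 1" using f nrm x by simp
  moreover have ux: "u x = 1" using x[OF u(1)] \<phi>u by simp
  moreover have "1 \<le> norm x"
    using norm_blinfun[of u x] ux u(2) mult_right_mono[of "norm u" 1 "norm x"] by simp
  ultimately show ?thesis using x by fastforce
qed

lemma eval_support_functional:
  assumes u: "u \<in> dual_space smul" "norm u \<le> 1" and x: "norm x = 1" "u x = 1"
  shows "(\<lambda>f. blinfun_apply f x) \<in> support_functionals (dual_space smul) (blinfun_scale (*)) u"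
proof -
  interpret scalars: normed_space_over "(*) :: 'k \<Rightarrow> 'k \<Rightarrow> 'k"
    by (rule normed_space_over_mult)
  have "\<exists>B. \<forall>f\<in>dual_space smul. norm (blinfun_apply f x) \<le> B * norm f"
    by (intro exI[of _ 1] ballI order_trans[OF norm_blinfun]) (simp add: x)
  then have "bounded_functional_on (dual_space smul) (blinfun_scale (*)) (\<lambda>f. blinfun_apply f x)"
    by (simp add: bounded_functional_on_def blinfun.add_left scalars.blinfun_scale_apply)
  moreover have "functional_norm_on (dual_space smul) (\<lambda>f. blinfun_apply f x) = 1"
    unfolding functional_norm_on_def
  proof (rule cSup_eq_maximum)
    show "1 \<in> {norm (blinfun_apply f x) | f. f \<in> dual_space smul \<and> norm f \<le> 1}"
      using u x(2) by (intro CollectI exI[of _ u]) simp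
    show "c \<le> 1" if "c \<in> {norm (blinfun_apply f x) | f. f \<in> dual_space smul \<and> norm f \<le> 1}" for c
      using that x(1) by (auto intro: order_trans[OF norm_blinfun])
  qed
  ultimately show ?thesis
    by (simp add: support_functionals_def x(2))
qed

lemma support_seminorm_dual:
  assumes refl: "reflexive_space smul" and u: "u \<in> dual_space smul" "norm u \<le> 1"
    and y: "y \<in> dual_space smul"
  shows "support_seminorm (dual_space smul) (blinfun_scale (*)) u y =
    Sup {norm (blinfun_apply y x) | x. norm x = 1 \<and> u x = 1}"
proof -
  have "{norm (\<phi> y) | \<phi>. \<phi> \<in> support_functionals (dual_space smul) (blinfun_scale (*)) u} =
      {norm (blinfun_apply y x) | x. norm x = 1 \<and> u x = 1}" (is "?L = ?R")
  proof
    show "?L \<subseteq> ?R" using support_functional_eval[OF refl u] y by fastforce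
    show "?R \<subseteq> ?L" using eval_support_functional[OF u] by fastforce
  qed
  then show ?thesis by (simp add: support_seminorm_def)
qed

lemma support_seminorm_dual_upper:
  assumes "reflexive_space smul" "u \<in> dual_space smul" "norm u \<le> 1" "y \<in> dual_space smul"
    and x: "norm x = 1" "u x = 1"
  shows "norm (y x) \<le> support_seminorm (dual_space smul) (blinfun_scale (*)) u y"
  unfolding support_seminorm_dual[OF assms(1-4)]
proof (rule cSup_upper)
  show "bdd_above {norm (blinfun_apply y x) | x. norm x = 1 \<and> u x = 1}"
  proof (rule bdd_aboveI, clarify)
    fix x :: 'a assume "norm x = 1"
    then show "norm (y x) \<le> norm y" using norm_blinfun[of y x] by simp
  qed
qed (use x in blast)

lemma support_seminorm_dual_least:
  assumes "reflexive_space smul" "u \<in> dual_space smul" "norm u \<le> 1" "y \<in> dual_space smul"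
    and ne: "\<exists>x. norm x = 1 \<and> u x = 1"
    and le: "\<And>x. norm x = 1 \<Longrightarrow> u x = 1 \<Longrightarrow> norm (y x) \<le> b"
  shows "support_seminorm (dual_space smul) (blinfun_scale (*)) u y \<le> b"
  unfolding support_seminorm_dual[OF assms(1-4)]
  by (rule cSup_least) (use ne le in auto)

lemma extreme_representatives_dual:
  assumes "extreme_representatives smul E" "e \<in> E"
  shows "e \<in> dual_space smul" "norm e \<le> 1"
  using assms
  by (auto simp: extreme_representatives_def dual_ball_extreme_points_def extreme_point_of_def)

lemma norm_functional_eq_one:
  assumes "norm f \<le> 1" "norm x = 1" "blinfun_apply f x = (1::'k)"
  shows "norm f = 1"
  using assms norm_blinfun[of f x] by simp

text \<open>
  For a fixed \<open>x\<close>, the functionals of norm one with value \<open>1\<close> at \<open>x\<close> form a face of the dual ball,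
  so the extreme points determine the numerical radius; the unimodular factor that separates an
  extreme point from its representative can be moved to the vector.
\<close>

lemma numerical_radius_least:
  assumes E: "extreme_representatives smul E"
    and R: "\<And>c x. blinfun_apply R (smul c x) = smul c (R x)"
    and ne: "\<exists>f\<in>dual_space smul. \<exists>x. norm f = 1 \<and> norm x = 1 \<and> blinfun_apply f x = 1"
    and le: "\<And>e x. e \<in> E \<Longrightarrow> norm x = 1 \<Longrightarrow> e x = 1 \<Longrightarrow> norm (e (R x)) \<le> b"
  shows "numerical_radius smul R \<le> b"
  unfolding numerical_radius_def
proof (rule cSup_least)
  show "{norm (blinfun_apply f (blinfun_apply R x)) | x f.
      norm x = 1 \<and> f \<in> dual_space smul \<and> norm f = 1 \<and> blinfun_apply f x = 1} \<noteq> {}"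
    using ne by blast
next
  interpret scalars: normed_space_over "(*) :: 'k \<Rightarrow> 'k \<Rightarrow> 'k"
    by (rule normed_space_over_mult)
  fix a assume "a \<in> {norm (blinfun_apply f (blinfun_apply R x)) | x f.
      norm x = 1 \<and> f \<in> dual_space smul \<and> norm f = 1 \<and> blinfun_apply f x = 1}"
  then obtain x and f :: "'a \<Rightarrow>\<^sub>L 'k" where a: "a = norm (f (R x))" and x: "norm x = 1"
    and f: "f \<in> dual_space smul" "norm f = 1" "f x = 1" by blast
  obtain g where g: "g \<in> dual_ball_extreme_points smul" "g x = 1" "norm (f (R x)) \<le> norm (g (R x))"
    using extreme_point_dominating[OF f(1) _ x f(3), of "R x"] f(2) by auto
  then obtain c e where e: "e \<in> E" "norm c = 1" "g = blinfun_scale (*) c e"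
    using E unfolding extreme_representatives_def by blast
  have eg: "e (smul c y) = g y" for y
    using extreme_representatives_dual[OF E e(1)] e(3)
    by (simp add: dual_scale scalars.blinfun_scale_apply)
  have "norm (e (R (smul c x))) \<le> b"
    by (rule le[OF e(1)]) (simp_all add: norm_scale e(2) x eg g(2))
  with g(3) show "a \<le> b" by (simp add: a R eg)
qed

lemma adjoint_operator_apply: "adjoint_operator R f x = f (blinfun_apply R x)"
  by (simp add: adjoint_operator_def)

lemma adjoint_operator_dual:
  assumes "f \<in> dual_space smul" "\<And>c x. blinfun_apply R (smul c x) = smul c (R x)"
  shows "adjoint_operator R f \<in> dual_space smul"
  using assms by (simp add: dual_space_def adjoint_operator_apply)

lemma adjoint_operator_add_scale:
  assumes "f \<in> dual_space smul"
  shows "adjoint_operator (R + blinfun_scale smul c S) f =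
    adjoint_operator R f + blinfun_scale (*) c (adjoint_operator S f)"
proof -
  interpret scalars: normed_space_over "(*) :: 'k \<Rightarrow> 'k \<Rightarrow> 'k"
    by (rule normed_space_over_mult)
  show ?thesis
    by (rule blinfun_eqI) (use assms in \<open>simp add: adjoint_operator_apply blinfun.bilinear_simps
        blinfun_scale_apply scalars.blinfun_scale_apply dual_scale\<close>)
qed

lemma support_seminorm_adjoint_le_numerical_radius:
  assumes refl: "reflexive_space smul" and u: "u \<in> dual_space smul" "norm u \<le> 1"
    and ne: "\<exists>x. norm x = 1 \<and> u x = 1"
    and R: "\<And>c x. blinfun_apply R (smul c x) = smul c (R x)"
  shows "support_seminorm (dual_space smul) (blinfun_scale (*)) u (adjoint_operator R u)
    \<le> numerical_radius smul R"
proof (rule support_seminorm_dual_least[OF refl u adjoint_operator_dual[OF u(1) R] ne])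
  fix x assume x: "norm x = 1" "u x = 1"
  show "norm (adjoint_operator R u x) \<le> numerical_radius smul R"
    using numerical_radius_upper[OF x(1) u(1) norm_functional_eq_one[OF u(2) x] x(2)]
    by (simp add: adjoint_operator_apply)
qed

section \<open>Transfer of orthogonality\<close>

text \<open>
  The reason is convexity: if \<open>T + c S\<close> were strictly smaller than \<open>T\<close> at \<open>x0\<close>, then so
  would be \<open>T + t c S\<close> for small \<open>t > 0\<close>, and the contribution of the other representatives, on which
  \<open>T\<close> vanishes, is of order \<open>t\<close>.
\<close>

lemma nr_orthogonal_imp_adjoint_orthogonal:
  assumes refl: "reflexive_space smul" and E: "extreme_representatives smul E" and x0: "x0 \<in> E"
    and T: "\<And>c x. blinfun_apply T (smul c x) = smul c (T x)"
    and S: "\<And>c x. blinfun_apply S (smul c x) = smul c (S x)"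
    and vanish: "\<And>f x. f \<in> E \<Longrightarrow> f \<noteq> x0 \<Longrightarrow> norm x = 1 \<Longrightarrow> f x = 1 \<Longrightarrow> f (T x) = 0"
    and orth: "orthogonal_wrt (numerical_radius smul) (blinfun_scale smul) T S"
  shows "orthogonal_wrt (support_seminorm (dual_space smul) (blinfun_scale (*)) x0)
           (blinfun_scale (*)) (adjoint_operator T x0) (adjoint_operator S x0)"
proof (rule ccontr)
  define w where "w = (numerical_radius smul :: _ \<Rightarrow> real)"
  define v where "v = (\<lambda>R. support_seminorm (dual_space smul) (blinfun_scale (*)) x0 (adjoint_operator R x0))"
  have lin: "(T + blinfun_scale smul c S) (smul d x) = smul d ((T + blinfun_scale smul c S) x)" for c d x
    by (simp add: blinfun.add_left blinfun_scale_apply T S scale_right_distrib mult.commute)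
  note dual = extreme_representatives_dual[OF E]
  assume "\<not> ?thesis"
  then obtain c where c: "v (T + blinfun_scale smul c S) < v T"
    using dual[OF x0] by (auto simp: orthogonal_wrt_def v_def adjoint_operator_add_scale not_le)
  let ?Q = "T + blinfun_scale smul c S"
  have ne: "\<exists>x. norm x = 1 \<and> x0 x = 1"
  proof (rule ccontr)
    assume "\<not> ?thesis"
    then have empty: "{norm (blinfun_apply y x) | x. norm x = 1 \<and> x0 x = 1} = {}" for y :: "'a \<Rightarrow>\<^sub>L 'k"
      by blast
    have "v ?Q = v T"
      unfolding v_def
        support_seminorm_dual[OF refl dual[OF x0] adjoint_operator_dual[OF dual(1)[OF x0] lin[of c]]]
        support_seminorm_dual[OF refl dual[OF x0] adjoint_operator_dual[OF dual(1)[OF x0] T]]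
        empty ..
    with c show False by simp
  qed
  have v_upper: "norm (x0 (blinfun_apply R x)) \<le> v R"
    if "norm x = 1" "x0 x = 1" "\<And>c x. blinfun_apply R (smul c x) = smul c (R x)" for R x
    using support_seminorm_dual_upper[OF refl dual[OF x0] adjoint_operator_dual[OF dual(1)[OF x0] that(3)] that(1,2)]
    by (simp add: v_def adjoint_operator_apply)
  have w_upper: "norm (e (blinfun_apply R x)) \<le> w R" if "e \<in> E" "norm x = 1" "e x = 1" for e R x
    unfolding w_def
    by (intro numerical_radius_upper norm_functional_eq_one[of e x] dual that)
  obtain z where z: "norm z = 1" "x0 z = 1" using ne by blast
  have Q0: "0 \<le> v ?Q" using order_trans[OF norm_ge_zero v_upper[OF z lin[of c]]] .
  have S0: "0 \<le> w S" using order_trans[OF norm_ge_zero w_upper[OF x0 z]] .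
  define M where "M = norm c * w S"
  \<comment> \<open>The other representatives contribute at most \<open>t * M\<close>, which has to stay below \<open>v T\<close>.\<close>
  define t where "t = v T / (v T + M)"
  have "0 \<le> M" using S0 by (simp add: M_def)
  moreover have T0: "0 < v T" using Q0 c by simp
  ultimately have t: "0 < t" "t \<le> 1" and tM: "t * M < v T"
    by (simp_all add: t_def field_simps)
  define b where "b = max ((1 - t) * v T + t * v ?Q) (t * M)"
  have "t * v ?Q < t * v T" using t(1) c by simp
  then have b: "b < v T" using tM by (simp add: b_def algebra_simps)
  let ?R = "T + blinfun_scale smul (of_real t * c) S"
  have "w ?R \<le> b"
    unfolding w_def
  proof (rule numerical_radius_least[OF E lin])
    show "\<exists>f\<in>dual_space smul. \<exists>x. norm f = 1 \<and> norm x = 1 \<and> blinfun_apply f x = (1::'k)"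
      using z dual[OF x0] norm_functional_eq_one by blast
    fix e x assume e: "e \<in> E" and x: "norm x = 1" "e x = 1"
    have eR: "e (?R x) = e (T x) + of_real t * c * e (S x)"
      using dual[OF e] by (simp add: blinfun.bilinear_simps blinfun_scale_apply dual_scale)
    show "norm (e (?R x)) \<le> b"
    proof (cases "e = x0")
      case True
      have "e (?R x) = of_real (1 - t) * x0 (T x) + of_real t * x0 (?Q x)"
        using dual[OF e] unfolding eR True
        by (simp add: blinfun.bilinear_simps blinfun_scale_apply dual_scale algebra_simps)
      also have "norm \<dots> \<le> norm (of_real (1 - t) * x0 (T x)) + norm (of_real t * x0 (?Q x))"
        by (rule norm_triangle_ineq)
      also have "\<dots> = (1 - t) * norm (x0 (T x)) + t * norm (x0 (?Q x))"
        using t by (simp only: norm_mult norm_of_real)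
      also have "\<dots> \<le> (1 - t) * v T + t * v ?Q"
        using t x True by (intro add_mono mult_left_mono v_upper T lin) auto
      finally show ?thesis by (simp add: b_def)
    next
      case False
      then have "norm (e (?R x)) = t * (norm c * norm (e (S x)))"
        using vanish[OF e False x] t by (simp add: eR norm_mult)
      also have "\<dots> \<le> t * M"
        unfolding M_def using t by (intro mult_left_mono w_upper e x) auto
      finally show ?thesis by (simp add: b_def)
    qed
  qed
  moreover have "v T \<le> w T"
    unfolding v_def w_def
    by (rule support_seminorm_adjoint_le_numerical_radius[OF refl dual[OF x0] ne T])
  ultimately have "w ?R < w T" using b by simp
  moreover have "w T \<le> w ?R"
    using orth by (simp add: orthogonal_wrt_def w_def)
  ultimately show False by simp
qed

text \<open>Adding a multiple of \<open>T\<close> to \<open>S\<close> does not change the values at the representatives other than \<open>x0\<close>.\<close>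

lemma adjoint_orthogonal_imp_nr_orthogonal:
  assumes refl: "reflexive_space smul" and E: "extreme_representatives smul E" and x0: "x0 \<in> E"
    and T: "\<And>c x. blinfun_apply T (smul c x) = smul c (T x)"
    and S: "\<And>c x. blinfun_apply S (smul c x) = smul c (S x)"
    and vanish: "\<And>f x. f \<in> E \<Longrightarrow> f \<noteq> x0 \<Longrightarrow> norm x = 1 \<Longrightarrow> f x = 1 \<Longrightarrow> f (T x) = 0"
    and orth: "orthogonal_wrt (support_seminorm (dual_space smul) (blinfun_scale (*)) x0)
           (blinfun_scale (*)) (adjoint_operator S x0) (adjoint_operator T x0)"
  shows "orthogonal_wrt (numerical_radius smul :: _ \<Rightarrow> real) (blinfun_scale smul) S T"
  unfolding orthogonal_wrt_def
proof
  fix c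
  note dual = extreme_representatives_dual[OF E]
  let ?R = "S + blinfun_scale smul c T"
  have R: "?R (smul d x) = smul d (?R x)" for d x
    by (simp add: blinfun.add_left blinfun_scale_apply T S scale_right_distrib mult.commute)
  show "numerical_radius smul S \<le> numerical_radius smul ?R"
  proof (cases "\<exists>f\<in>dual_space smul. \<exists>x. norm f = 1 \<and> norm x = 1 \<and> blinfun_apply f x = (1::'k)")
    case False
    \<comment> \<open>Then the space is trivial, and both sides are the supremum of the empty set.\<close>
    then have empty: "{norm (blinfun_apply f (blinfun_apply Q x)) | x f. norm x = 1 \<and>
        f \<in> dual_space smul \<and> norm f = 1 \<and> blinfun_apply f x = 1} = {}" for Q
      by blast
    show ?thesis unfolding numerical_radius_def empty ..
  next
    case True
    show ?thesis
    proof (rule numerical_radius_least[OF E S True])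
      fix e x assume e: "e \<in> E" and x: "norm x = 1" "e x = 1"
      show "norm (e (S x)) \<le> numerical_radius smul ?R"
      proof (cases "e = x0")
        case True
        let ?v = "\<lambda>Q. support_seminorm (dual_space smul) (blinfun_scale (*)) x0 (adjoint_operator Q x0)"
        have "norm (e (S x)) \<le> ?v S"
          using support_seminorm_dual_upper[OF refl dual[OF x0] adjoint_operator_dual[OF dual(1)[OF x0] S], of x] x
          by (simp add: adjoint_operator_apply True)
        also have "\<dots> \<le> ?v ?R"
          using orth dual[OF x0] by (simp add: orthogonal_wrt_def adjoint_operator_add_scale)
        also have "\<dots> \<le> numerical_radius smul ?R"
          using x True
          by (intro support_seminorm_adjoint_le_numerical_radius refl dual x0 R) blast
        finally show ?thesis .
      next
        case False
        have "e (?R x) = e (S x)"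
          using dual[OF e] vanish[OF e False x]
          by (simp add: blinfun.bilinear_simps blinfun_scale_apply dual_scale)
        then show ?thesis
          using numerical_radius_upper[of x e ?R] norm_functional_eq_one[of e x] dual[OF e] x by simp
      qed
    qed
  qed
qed

end

theorem proposition3p19:
  fixes smul :: "'k::real_or_complex \<Rightarrow> 'a::banach \<Rightarrow> 'a"
    and T :: "'a \<Rightarrow>\<^sub>L 'a"
    and E :: "('a \<Rightarrow>\<^sub>L 'k) set"
    and x0 :: "'a \<Rightarrow>\<^sub>L 'k"
  assumes "normed_space_over smul"
    and "reflexive_space smul"
    and "T \<in> compact_operators smul"
    and "extreme_representatives smul E"
    and "x0 \<in> E"
    and "\<forall>f \<in> E - {x0}. \<forall>x. norm x = 1 \<and> blinfun_apply f x = 1 \<longrightarrow>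
           blinfun_apply f (blinfun_apply T x) = 0"
    and "left_symmetric_wrt
           (support_seminorm (dual_space smul) (blinfun_scale (*)) x0)
           (dual_space smul) (blinfun_scale (*)) (adjoint_operator T x0)"
  shows "nr_left_symmetric smul T"
proof -
  interpret normed_space_over smul by fact
  have T: "T (smul c x) = smul c (T x)" for c x
    using assms(3) by (simp add: compact_operators_def)
  have vanish: "f (T x) = 0" if "f \<in> E" "f \<noteq> x0" "norm x = 1" "f x = 1" for f x
    using assms(6) that by blast
  have "orthogonal_wrt (numerical_radius smul) (blinfun_scale smul) S T"
    if S_in: "S \<in> compact_operators smul"
      and orth: "orthogonal_wrt (numerical_radius smul) (blinfun_scale smul) T S" for S
  proof -
    have S: "S (smul c x) = smul c (S x)" for c x
      using S_in by (simp add: compact_operators_def)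
    have "adjoint_operator S x0 \<in> dual_space smul"
      using extreme_representatives_dual(1)[OF assms(4,5)] S by (rule adjoint_operator_dual)
    moreover have "orthogonal_wrt (support_seminorm (dual_space smul) (blinfun_scale (*)) x0)
           (blinfun_scale (*)) (adjoint_operator T x0) (adjoint_operator S x0)"
      using nr_orthogonal_imp_adjoint_orthogonal[OF assms(2,4,5) T S] vanish orth by blast
    ultimately have "orthogonal_wrt (support_seminorm (dual_space smul) (blinfun_scale (*)) x0)
           (blinfun_scale (*)) (adjoint_operator S x0) (adjoint_operator T x0)"
      using assms(7) unfolding left_symmetric_wrt_def by blast
    then show ?thesis
      using adjoint_orthogonal_imp_nr_orthogonal[OF assms(2,4,5) T S] vanish by blast
  qed
  then show ?thesis
    using assms(3) unfolding nr_left_symmetric_def left_symmetric_wrt_def by blast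
qed

end
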